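(* Let $Q$ be a quiver of type $ADE$ with Ringel form $R$, and let $\tilde{w}_0=s_{i_1}\cdots s_{i_N}$ be a reduced expression of $w_0$ adapted to $Q$. Let $\mathcal{C}_{\tilde{w}_0}$ be the set of weights $\mu_k=s_{i_1}\cdots s_{i_k}(\omega_{i_k})$, $1\le k\le N$. Then $-\rho_i\in\mathcal{C}_{\tilde{w}_0}$ for every $i\in I$, and $\mathcal{C}_{\tilde{w}_0}$ is obtained from the $-\rho_i$ by the same linear combinations which construct $\Phi^+$ out of the simple roots, i.e. $$\mathcal{C}_{\tilde{w}_0}=\Big\{\sum_{i\in I}a_i(-\rho_i)\ :\ \sum_{i\in I}a_i\alpha_i\in\Phi^+\Big\}.$$
   Context: Let $D$ be a Dynkin diagram of type $ADE$ with vertex set $I=\{1,\dots,n\}$, $\Phi$ its root system in the real Euclidean space $E$, $\Phi^+$ the positive roots, $N=|\Phi^+|$, $\alpha_i$ the simple roots, $\omega_i\in E$ the fundamental weights, $W$ the Weyl group with simple reflections $s_i$, and $w_0$ its longest element. A quiver $Q$ of type $ADE$ is an orientation of the edges of such a $D$. A vertex $k$ is a sink of $Q$ if all arrows incident to $k$ enter $k$; then $S_kQ$ denotes the quiver obtained by reversing all arrows ending at $k$. A reduced expression $s_{i_1}\cdots s_{i_N}$ of $w_0$ is adapted to $Q$ if $i_1$ is a sink of $Q$, $i_2$ is a sink of $S_{i_1}Q$, $i_3$ is a sink of $S_{i_2}S_{i_1}Q$, and so on. The Ringel form $R$ of $Q$ is the bilinear form on $E$ with $r_{i,j}:=R(\alpha_i,\alpha_j)$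 equal to $1$ if $i=j$, to $-1$ if there is an arrow $i\to j$ in $Q$, and to $0$ otherwise. For $i\in I$ put $\rho_i=\sum_{l\in I}r_{l,i}\,\omega_l$. *)

theory Defs
  imports "HOL-Analysis.Analysis"
begin

subsection \<open>Dynkin diagrams of type ADE\<close>

text \<open>A diagram with vertex set \<open>{1..n}\<close> is given by its set of edges, an edge being a
  two-element set of vertices. The standard labellings are those of Bourbaki.\<close>

definition edges_A :: "nat \<Rightarrow> nat set set" where
  "edges_A n = {{i, Suc i} | i. 1 \<le> i \<and> Suc i \<le> n}"

definition edges_D :: "nat \<Rightarrow> nat set set" where
  "edges_D n = {{i, Suc i} | i. 1 \<le> i \<and> Suc i \<le> n - 1} \<union> {{n - 2, n}}"

definition edges_E :: "nat \<Rightarrow> nat set set" where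
  "edges_E n = {{1, 3}, {2, 4}} \<union> {{i, Suc i} | i. 3 \<le> i \<and> Suc i \<le> n}"

definition ADE_diagram :: "nat \<Rightarrow> nat set set \<Rightarrow> bool" where
  "ADE_diagram n D \<longleftrightarrow>
     (\<exists>\<pi> D0. bij_betw \<pi> {1..n} {1..n} \<and> D = (`) \<pi> ` D0 \<and>
        (n \<ge> 1 \<and> D0 = edges_A n \<or> n \<ge> 4 \<and> D0 = edges_D n \<or> n \<in> {6, 7, 8} \<and> D0 = edges_E n))"

subsection \<open>Root systems\<close>

definition cartan :: "'a::euclidean_space \<Rightarrow> 'a \<Rightarrow> real" where
  "cartan x a = 2 * (x \<bullet> a) / (a \<bullet> a)"

definition reflection :: "'a::euclidean_space \<Rightarrow> 'a \<Rightarrow> 'a" where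
  "reflection a x = x - cartan x a *\<^sub>R a"

definition root_system :: "'a::euclidean_space set \<Rightarrow> bool" where
  "root_system \<Phi> \<longleftrightarrow> finite \<Phi> \<and> 0 \<notin> \<Phi> \<and> span \<Phi> = UNIV \<and>
     (\<forall>a\<in>\<Phi>. reflection a ` \<Phi> = \<Phi>) \<and>
     (\<forall>a\<in>\<Phi>. \<forall>b\<in>\<Phi>. cartan b a \<in> \<int>) \<and>
     (\<forall>a\<in>\<Phi>. \<forall>c. c *\<^sub>R a \<in> \<Phi> \<longrightarrow> c = 1 \<or> c = -1)"

definition positive_roots :: "'a::euclidean_space set \<Rightarrow> nat \<Rightarrow> (nat \<Rightarrow> 'a) \<Rightarrow> 'a set" where
  "positive_roots \<Phi> n \<alpha> = {b \<in> \<Phi>. \<exists>c::nat \<Rightarrow> nat. b = (\<Sum>i\<in>{1..n}. real (c i) *\<^sub>R \<alpha> i)}"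

definition simple_roots :: "'a::euclidean_space set \<Rightarrow> nat \<Rightarrow> (nat \<Rightarrow> 'a) \<Rightarrow> bool" where
  "simple_roots \<Phi> n \<alpha> \<longleftrightarrow> \<alpha> ` {1..n} \<subseteq> \<Phi> \<and> inj_on \<alpha> {1..n} \<and> independent (\<alpha> ` {1..n}) \<and>
     (\<forall>b\<in>\<Phi>. b \<in> positive_roots \<Phi> n \<alpha> \<or> -b \<in> positive_roots \<Phi> n \<alpha>)"

text \<open>The root system \<open>\<Phi>\<close> with simple roots \<open>\<alpha>\<^sub>i\<close> has the simply laced Dynkin diagram \<open>D\<close>. The
  length of the roots is not normalised.\<close>

definition has_diagram :: "nat \<Rightarrow> nat set set \<Rightarrow> (nat \<Rightarrow> 'a::euclidean_space) \<Rightarrow> bool" where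
  "has_diagram n D \<alpha> \<longleftrightarrow> (\<forall>i\<in>{1..n}. \<forall>j\<in>{1..n}.
     cartan (\<alpha> i) (\<alpha> j) = (if i = j then 2 else if {i, j} \<in> D then -1 else 0))"

definition fundamental_weights ::
    "nat \<Rightarrow> (nat \<Rightarrow> 'a::euclidean_space) \<Rightarrow> (nat \<Rightarrow> 'a) \<Rightarrow> bool" where
  "fundamental_weights n \<alpha> \<omega> \<longleftrightarrow>
     (\<forall>i\<in>{1..n}. \<forall>j\<in>{1..n}. cartan (\<omega> i) (\<alpha> j) = (if i = j then 1 else 0))"

subsection \<open>The Weyl group\<close>

inductive_set weyl_group :: "'a::euclidean_space set \<Rightarrow> ('a \<Rightarrow> 'a) set" for \<Phi> where
  weyl_id: "id \<in> weyl_group \<Phi>"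
| weyl_step: "a \<in> \<Phi> \<Longrightarrow> w \<in> weyl_group \<Phi> \<Longrightarrow> reflection a \<circ> w \<in> weyl_group \<Phi>"

text \<open>\<open>word_map \<alpha> [i\<^sub>1, \<dots>, i\<^sub>m]\<close> is the product \<open>s\<^bsub>i\<^sub>1\<^esub> \<cdots> s\<^bsub>i\<^sub>m\<^esub>\<close>, whose last letter acts first.\<close>

definition word_map :: "(nat \<Rightarrow> 'a::euclidean_space) \<Rightarrow> nat list \<Rightarrow> 'a \<Rightarrow> 'a" where
  "word_map \<alpha> is = foldr (\<lambda>i w. reflection (\<alpha> i) \<circ> w) is id"

definition weyl_length :: "nat \<Rightarrow> (nat \<Rightarrow> 'a::euclidean_space) \<Rightarrow> ('a \<Rightarrow> 'a) \<Rightarrow> nat" where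
  "weyl_length n \<alpha> w =
     (LEAST m. \<exists>is. set is \<subseteq> {1..n} \<and> length is = m \<and> word_map \<alpha> is = w)"

definition reduced_expression ::
    "nat \<Rightarrow> (nat \<Rightarrow> 'a::euclidean_space) \<Rightarrow> nat list \<Rightarrow> ('a \<Rightarrow> 'a) \<Rightarrow> bool" where
  "reduced_expression n \<alpha> is w \<longleftrightarrow>
     set is \<subseteq> {1..n} \<and> word_map \<alpha> is = w \<and> length is = weyl_length n \<alpha> w"

definition longest_element ::
    "'a::euclidean_space set \<Rightarrow> nat \<Rightarrow> (nat \<Rightarrow> 'a) \<Rightarrow> ('a \<Rightarrow> 'a) \<Rightarrow> bool" where
  "longest_element \<Phi> n \<alpha> w0 \<longleftrightarrow> is_arg_max (weyl_length n \<alpha>) (\<lambda>w. w \<in> weyl_group \<Phi>) w0"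

subsection \<open>Quivers and adapted expressions\<close>

text \<open>A pair \<open>(i, j)\<close> is an arrow \<open>i \<rightarrow> j\<close>.\<close>

definition orientation_of :: "nat set set \<Rightarrow> (nat \<times> nat) set \<Rightarrow> bool" where
  "orientation_of D Q \<longleftrightarrow> (\<forall>i j. (i, j) \<in> Q \<longrightarrow> {i, j} \<in> D) \<and>
     (\<forall>i j. {i, j} \<in> D \<longrightarrow> ((i, j) \<in> Q) \<noteq> ((j, i) \<in> Q))"

definition is_sink :: "(nat \<times> nat) set \<Rightarrow> nat \<Rightarrow> bool" where
  "is_sink Q k \<longleftrightarrow> (\<forall>j. (k, j) \<notin> Q)"

definition flip_at :: "nat \<Rightarrow> (nat \<times> nat) set \<Rightarrow> (nat \<times> nat) set" where
  "flip_at k Q = {(i, j). (i, j) \<in> Q \<and> j \<noteq> k} \<union> {(k, i) | i. (i, k) \<in> Q}"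

fun adapted :: "(nat \<times> nat) set \<Rightarrow> nat list \<Rightarrow> bool" where
  "adapted Q [] \<longleftrightarrow> True"
| "adapted Q (i # is) \<longleftrightarrow> is_sink Q i \<and> adapted (flip_at i Q) is"

subsection \<open>The Ringel form\<close>

definition ringel_form ::
    "nat \<Rightarrow> (nat \<Rightarrow> 'a::euclidean_space) \<Rightarrow> (nat \<times> nat) set \<Rightarrow> ('a \<Rightarrow> 'a \<Rightarrow> real) \<Rightarrow> bool" where
  "ringel_form n \<alpha> Q R \<longleftrightarrow> bilinear R \<and> (\<forall>i\<in>{1..n}. \<forall>j\<in>{1..n}.
     R (\<alpha> i) (\<alpha> j) = (if i = j then 1 else if (i, j) \<in> Q then -1 else 0))"

definition rho ::
    "nat \<Rightarrow> (nat \<Rightarrow> 'a::euclidean_space) \<Rightarrow> (nat \<Rightarrow> 'a) \<Rightarrow> ('a \<Rightarrow> 'a \<Rightarrow> real) \<Rightarrow> nat \<Rightarrow> 'a" where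
  "rho n \<alpha> \<omega> R i = (\<Sum>l\<in>{1..n}. R (\<alpha> l) (\<alpha> i) *\<^sub>R \<omega> l)"

text \<open>The weights \<open>\<mu>\<^sub>k = s\<^bsub>i\<^sub>1\<^esub> \<cdots> s\<^bsub>i\<^sub>k\<^esub> (\<omega>\<^bsub>i\<^sub>k\<^esub>)\<close>; list positions start at \<open>0\<close>, so that \<open>i\<^sub>k\<close> is
  \<open>is ! (k - 1)\<close>. For a reduced expression of the longest element the number of letters is
  the number of positive roots.\<close>

definition chamber_weights ::
    "(nat \<Rightarrow> 'a::euclidean_space) \<Rightarrow> (nat \<Rightarrow> 'a) \<Rightarrow> nat list \<Rightarrow> 'a set" where
  "chamber_weights \<alpha> \<omega> is =
     {word_map \<alpha> (take k is) (\<omega> (is ! (k - 1))) | k. 1 \<le> k \<and> k \<le> length is}"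

end

theory Submission
  imports Defs
begin

text \<open>Write \<open>\<beta>\<^sub>k = s\<^bsub>i\<^sub>1\<^esub> \<cdots> s\<^bsub>i\<^sub>k\<^sub>-\<^sub>1\<^esub>(\<alpha>\<^bsub>i\<^sub>k\<^esub>)\<close>. For a reduced expression of \<open>w\<^sub>0\<close> these are exactly the
  positive roots. If \<open>j\<close> is a sink of \<open>Q\<close>, then \<open>(x, y) \<mapsto> R (s\<^sub>j x) (s\<^sub>j y)\<close> is the Ringel form of
  \<open>S\<^sub>j Q\<close>; by induction along an adapted expression, \<open>\<mu>\<^sub>k\<close> pairs with the coroot of \<open>\<alpha>\<^sub>l\<close> to
  \<open>- R \<alpha>\<^sub>l \<beta>\<^sub>k\<close>. Hence \<open>\<mu>\<^sub>k\<close> is the image of \<open>\<beta>\<^sub>k\<close> under the linear map sending \<open>\<alpha>\<^sub>i\<close> to \<open>- \<rho>\<^sub>i\<close>.\<close>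

subsection \<open>Reflections and words\<close>

lemma cartan_add: "cartan (x + y) a = cartan x a + cartan y a"
  and cartan_scaleR: "cartan (c *\<^sub>R x) a = c * cartan x a"
  and cartan_diff: "cartan (x - y) a = cartan x a - cartan y a"
  by (simp_all add: cartan_def inner_simps add_divide_distrib diff_divide_distrib algebra_simps)

lemma linear_reflection: "linear (reflection a)"
  by (rule linearI) (simp_all add: reflection_def cartan_add cartan_scaleR algebra_simps)

lemma reflection_involution: "reflection a (reflection a x) = x"
  by (cases "a = 0") (simp_all add: reflection_def cartan_def inner_simps algebra_simps)

lemma reflection_comp_self: "reflection a \<circ> reflection a = id"
  by (simp add: fun_eq_iff reflection_involution)

lemma reflection_self: "reflection a a = - a"
  by (cases "a = 0") (simp_all add: reflection_def cartan_def scaleR_2)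

lemma orthogonal_transformation_reflection: "orthogonal_transformation (reflection a)"
  unfolding orthogonal_transformation_def
proof (intro conjI allI linear_reflection)
  show "reflection a v \<bullet> reflection a w = v \<bullet> w" for v w
    by (cases "a = 0")
      (simp_all add: reflection_def cartan_def inner_simps inner_commute divide_simps)
qed

text \<open>Orthogonal maps preserve Cartan numbers. In group terms this is
  \<open>f s_a = s_b f\<close> with \<open>b = f a\<close>, the conjugation rule that drives the
  exchange argument.\<close>

lemma reflection_conjugate:
  assumes "orthogonal_transformation f"
  shows "f (reflection a x) = reflection (f a) (f x)"
proof -
  have "linear f" and "\<And>v w. f v \<bullet> f w = v \<bullet> w"
    using assms by (auto simp: orthogonal_transformation_def)
  then show ?thesis
    by (simp add: reflection_def cartan_def linear_diff linear_scale)
qed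

lemma word_map_Nil [simp]: "word_map \<alpha> [] = id"
  and word_map_Cons [simp]: "word_map \<alpha> (i # is) = reflection (\<alpha> i) \<circ> word_map \<alpha> is"
  by (simp_all add: word_map_def)

lemma word_map_append: "word_map \<alpha> (is @ js) = word_map \<alpha> is \<circ> word_map \<alpha> js"
  by (induction "is") (simp_all add: comp_assoc)

lemma orthogonal_transformation_word_map: "orthogonal_transformation (word_map \<alpha> is)"
proof (induction "is")
  case Nil
  show ?case
    unfolding word_map_Nil id_def by (rule orthogonal_transformation_id)
next
  case (Cons i "is")
  show ?case
    unfolding word_map_Cons
    by (rule orthogonal_transformation_compose[OF orthogonal_transformation_reflection Cons])
qed

lemma linear_word_map: "linear (word_map \<alpha> is)"
  using orthogonal_transformation_word_map orthogonal_transformation_linear by blast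

lemma word_map_rev: "word_map \<alpha> is (word_map \<alpha> (rev is) x) = x"
  by (induction "is" arbitrary: x) (simp_all add: word_map_append reflection_involution)

lemma weyl_length_le:
  "set is \<subseteq> {1..n} \<Longrightarrow> weyl_length n \<alpha> (word_map \<alpha> is) \<le> length is"
  unfolding weyl_length_def by (rule Least_le) blast

text \<open>The minimum defining \<open>weyl_length\<close> is attained because the element is given
  by a word, so the set of candidate lengths is nonempty.\<close>

lemma reduced_expression_exists:
  assumes "set is \<subseteq> {1..n}"
  obtains js where "reduced_expression n \<alpha> js (word_map \<alpha> is)"
proof -
  have "\<exists>js. set js \<subseteq> {1..n} \<and> length js = weyl_length n \<alpha> (word_map \<alpha> is) \<and>
      word_map \<alpha> js = word_map \<alpha> is"
    unfolding weyl_length_def by (rule LeastI_ex) (use assms in blast)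
  then show thesis
    using that by (auto simp: reduced_expression_def)
qed

subsection \<open>Inversions of a reduced expression\<close>

locale simple_system =
  fixes \<Phi> :: "'a::euclidean_space set" and n :: nat and \<alpha> :: "nat \<Rightarrow> 'a"
  assumes root_system: "root_system \<Phi>" and simple_roots: "simple_roots \<Phi> n \<alpha>"
begin

section \<open>Positive roots and simple reflections\<close>

abbreviation pos :: "'a set" where "pos \<equiv> positive_roots \<Phi> n \<alpha>"

lemma simple_root_in: "i \<in> {1..n} \<Longrightarrow> \<alpha> i \<in> \<Phi>"
  using simple_roots by (auto simp: simple_roots_def)

lemma pos_in_roots: "b \<in> pos \<Longrightarrow> b \<in> \<Phi>"
  by (simp add: positive_roots_def)

lemma reflection_root: "a \<in> \<Phi> \<Longrightarrow> b \<in> \<Phi> \<Longrightarrow> reflection a b \<in> \<Phi>"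
  using root_system by (auto simp: root_system_def)

lemma word_map_root: "set is \<subseteq> {1..n} \<Longrightarrow> b \<in> \<Phi> \<Longrightarrow> word_map \<alpha> is b \<in> \<Phi>"
  by (induction "is") (auto intro!: reflection_root simple_root_in)

lemma word_map_in_weyl_group: "set is \<subseteq> {1..n} \<Longrightarrow> word_map \<alpha> is \<in> weyl_group \<Phi>"
  by (induction "is") (auto intro!: weyl_id weyl_step simple_root_in simp del: atLeastAtMost_iff)

lemma pos_or_neg: "b \<in> \<Phi> \<Longrightarrow> b \<in> pos \<or> - b \<in> pos"
  using simple_roots by (auto simp: simple_roots_def)

lemma simple_root_pos:
  assumes "i \<in> {1..n}"
  shows "\<alpha> i \<in> pos"
proof -
  have "(\<Sum>j\<in>{1..n}. real (if j = i then 1 else 0) *\<^sub>R \<alpha> j) = (\<Sum>j\<in>{1..n}. if j = i then \<alpha> j else 0)"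
    by (rule sum.cong) auto
  also have "\<dots> = \<alpha> i"
    using assms by simp
  finally show ?thesis
    using simple_root_in[OF assms] unfolding positive_roots_def
    by (intro CollectI conjI exI[of _ "\<lambda>j. if j = i then 1 else 0"]) simp_all
qed

text \<open>Independence of the set of simple roots is turned into independence of the indexed
  family, using injectivity of the indexing.\<close>

lemma simple_roots_coeff_zero:
  assumes "(\<Sum>i\<in>{1..n}. c i *\<^sub>R \<alpha> i) = 0" and "i \<in> {1..n}"
  shows "c i = 0"
proof -
  have inj: "inj_on \<alpha> {1..n}" and ind: "independent (\<alpha> ` {1..n})"
    using simple_roots by (auto simp: simple_roots_def)
  have "(\<Sum>v\<in>\<alpha> ` {1..n}. c (inv_into {1..n} \<alpha> v) *\<^sub>R v) = (\<Sum>i\<in>{1..n}. c i *\<^sub>R \<alpha> i)"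
    using inj by (simp add: sum.reindex)
  then have "c (inv_into {1..n} \<alpha> (\<alpha> i)) = 0"
    using assms by (intro independentD[OF ind]) auto
  then show ?thesis
    using inj assms(2) by simp
qed

lemma span_simple_roots: "span (\<alpha> ` {1..n}) = UNIV"
proof -
  have *: "b \<in> span (\<alpha> ` {1..n})" if "b \<in> pos" for b
    using that unfolding positive_roots_def
    by (auto intro!: span_sum span_scale intro: span_base)
  then have "\<Phi> \<subseteq> span (\<alpha> ` {1..n})"
    using pos_or_neg span_neg by (metis minus_minus subsetI)
  then show ?thesis
    using root_system by (metis root_system_def span_mono span_span top.extremum_uniqueI)
qed

text \<open>Adding the two expansions gives a relation with nonnegative coefficients, so all of them
  vanish; but 0 is no root.\<close>

lemma pos_not_neg:
  assumes "b \<in> pos"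
  shows "- b \<notin> pos"
proof
  assume "- b \<in> pos"
  with assms obtain c d :: "nat \<Rightarrow> nat"
    where c: "b = (\<Sum>i\<in>{1..n}. real (c i) *\<^sub>R \<alpha> i)" and d: "- b = (\<Sum>i\<in>{1..n}. real (d i) *\<^sub>R \<alpha> i)"
    by (auto simp: positive_roots_def)
  have "(\<Sum>i\<in>{1..n}. (real (c i) + real (d i)) *\<^sub>R \<alpha> i) = b + - b"
    unfolding d unfolding c by (simp add: scaleR_add_left sum.distrib)
  then have "real (c i) + real (d i) = 0" if "i \<in> {1..n}" for i
    using simple_roots_coeff_zero[of "\<lambda>i. real (c i) + real (d i)"] that by simp
  then have "b = 0"
    unfolding c by (intro sum.neutral) force
  then show False
    using pos_in_roots[OF assms] root_system by (simp add: root_system_def)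
qed

text \<open>The reflection \<open>s_i\<close> alters only the coefficient at
  \<alpha>\<open>i\<close>. Any other positive coefficient of \<open>b\<close> would survive in
  \<open>s_i b\<close> and keep it from being negative.\<close>

lemma simple_reflection_pos:
  assumes i: "i \<in> {1..n}" and b: "b \<in> pos" and neg: "- reflection (\<alpha> i) b \<in> pos"
  shows "b = \<alpha> i"
proof -
  obtain c d :: "nat \<Rightarrow> nat"
    where c: "b = (\<Sum>j\<in>{1..n}. real (c j) *\<^sub>R \<alpha> j)"
      and d: "- reflection (\<alpha> i) b = (\<Sum>j\<in>{1..n}. real (d j) *\<^sub>R \<alpha> j)"
    using b neg by (auto simp: positive_roots_def)
  define t where "t = cartan b (\<alpha> i)"
  \<comment> \<open>Since \<open>s_i b\<close> is \<open>b\<close> minus \<open>t\<close> times the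
    simple root, this combination is zero; its coefficients away from \<open>i\<close> are sums of
    two natural numbers.\<close>
  have "(\<Sum>j\<in>{1..n}. (real (c j) + real (d j) - (if j = i then t else 0)) *\<^sub>R \<alpha> j)
      = b + - reflection (\<alpha> i) b - (\<Sum>j\<in>{1..n}. (if j = i then t *\<^sub>R \<alpha> j else 0))"
    unfolding d unfolding c
    by (simp add: scaleR_add_left scaleR_diff_left sum.distrib sum_subtractf if_distrib[of "\<lambda>x. x *\<^sub>R _"] cong: if_cong)
  also have "\<dots> = 0"
    using i by (simp add: reflection_def t_def)
  finally have "real (c j) + real (d j) - (if j = i then t else 0) = 0" if "j \<in> {1..n}" for j
    using simple_roots_coeff_zero[of "\<lambda>j. real (c j) + real (d j) - (if j = i then t else 0)"] that
    by simp
  then have "c j = 0" if "j \<in> {1..n}" "j \<noteq> i" for j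
    using that by fastforce
  then have "b = (\<Sum>j\<in>{1..n}. if j = i then real (c j) *\<^sub>R \<alpha> j else 0)"
    unfolding c by (intro sum.cong) auto
  then have bi: "b = real (c i) *\<^sub>R \<alpha> i"
    using i by simp
  \<comment> \<open>The only multiples of a root that are roots are those by 1 and -1; the latter is
    excluded since \<open>c i\<close> is a natural number.\<close>
  then have "real (c i) = 1 \<or> real (c i) = -1"
    using pos_in_roots[OF b] simple_root_in[OF i] root_system unfolding root_system_def by blast
  then show ?thesis
    using bi by auto
qed

text \<open>Let the letters act on the simple root from right to left. At the letter
  \<open>i\<close> where it turns negative it must equal the simple root of \<open>i\<close>, and
  then \<open>i\<close> cancels against the appended \<open>j\<close>.\<close>

lemma exchange:
  assumes "set is \<subseteq> {1..n}" and "j \<in> {1..n}" and "- word_map \<alpha> is (\<alpha> j) \<in> pos"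
  shows "\<exists>js. set js \<subseteq> {1..n} \<and> length js < length is \<and>
    word_map \<alpha> (is @ [j]) = word_map \<alpha> js"
  using assms
proof (induction "is")
  case Nil
  then show ?case
    using pos_not_neg simple_root_pos by fastforce
next
  case (Cons i "is")
  let ?v = "word_map \<alpha> is"
  have i: "i \<in> {1..n}" and is_sub: "set is \<subseteq> {1..n}"
    using Cons.prems by auto
  show ?case
  proof (cases "- ?v (\<alpha> j) \<in> pos")
    case True
    then obtain js where "set js \<subseteq> {1..n}" "length js < length is"
      "word_map \<alpha> (is @ [j]) = word_map \<alpha> js"
      using Cons.IH is_sub Cons.prems(2) by blast
    with i show ?thesis
      by (intro exI[of _ "i # js"]) auto
  next
    case False
    then have "?v (\<alpha> j) \<in> pos"
      using pos_or_neg word_map_root[OF is_sub] simple_root_in Cons.prems(2) by blast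
    then have "?v (\<alpha> j) = \<alpha> i"
      using simple_reflection_pos[OF i] Cons.prems(3) by simp
    \<comment> \<open>As \<open>?v\<close> maps the root of \<open>j\<close> to the root of
      \<open>i\<close>, conjugation gives \<open>?v s_j = s_i ?v\<close>, and the two copies of
      \<open>s_i\<close> cancel.\<close>
    then have "word_map \<alpha> ((i # is) @ [j]) = ?v"
      by (simp add: fun_eq_iff word_map_append reflection_involution
          reflection_conjugate[OF orthogonal_transformation_word_map])
    then show ?thesis
      using is_sub by (intro exI[of _ "is"]) auto
  qed
qed

section \<open>Reduced words and the longest element\<close>

lemma reduced_prefix_root_pos:
  assumes red: "reduced_expression n \<alpha> (is @ j # js) w"
  shows "word_map \<alpha> is (\<alpha> j) \<in> pos"
proof (rule ccontr)
  assume *: "word_map \<alpha> is (\<alpha> j) \<notin> pos"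
  have sub: "set is \<subseteq> {1..n}" "j \<in> {1..n}" "set js \<subseteq> {1..n}"
    and w: "word_map \<alpha> (is @ j # js) = w" and len: "length (is @ j # js) = weyl_length n \<alpha> w"
    using red by (auto simp: reduced_expression_def)
  have "- word_map \<alpha> is (\<alpha> j) \<in> pos"
    using * pos_or_neg word_map_root simple_root_in sub by blast
  then obtain ks where ks: "set ks \<subseteq> {1..n}" "length ks < length is"
    "word_map \<alpha> (is @ [j]) = word_map \<alpha> ks"
    using exchange sub by blast
  have "w = word_map \<alpha> (is @ [j]) \<circ> word_map \<alpha> js"
    by (simp add: w[symmetric] word_map_append comp_assoc)
  also have "\<dots> = word_map \<alpha> (ks @ js)"
    unfolding ks(3) word_map_append[of \<alpha> ks js] ..
  \<comment> \<open>Exchange replaced the prefix \<open>is @ [j]\<close> by a shorter word, so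
    \<open>w\<close> has a word shorter than its reduced one.\<close>
  finally have "weyl_length n \<alpha> w \<le> length (ks @ js)"
    using weyl_length_le[of "ks @ js" n \<alpha>] ks(1) sub(3) by simp
  then show False
    using len ks(2) by simp
qed

text \<open>If \<open>w\<close> kept the simple root positive, \<open>w s_j\<close> would send it to
  a negative root; exchange would then make \<open>w\<close> strictly shorter than
  \<open>w s_j\<close>, against maximality.\<close>

lemma longest_element_simple_root_neg:
  assumes long: "longest_element \<Phi> n \<alpha> (word_map \<alpha> is)"
    and "is": "set is \<subseteq> {1..n}" and j: "j \<in> {1..n}"
  shows "- word_map \<alpha> is (\<alpha> j) \<in> pos"
proof (rule ccontr)
  assume "- word_map \<alpha> is (\<alpha> j) \<notin> pos"
  then have p: "word_map \<alpha> is (\<alpha> j) \<in> pos"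
    using pos_or_neg word_map_root simple_root_in "is" j by blast
  have sub: "set (is @ [j]) \<subseteq> {1..n}"
    using "is" j by simp
  \<comment> \<open>A reduced word is chosen for \<open>w s_j\<close>, so that the bound from
    exchange compares with its length and not merely with that of \<open>is @ [j]\<close>.\<close>
  then obtain ks where ks: "reduced_expression n \<alpha> ks (word_map \<alpha> (is @ [j]))"
    using reduced_expression_exists by blast
  then have ks': "set ks \<subseteq> {1..n}" "word_map \<alpha> ks = word_map \<alpha> (is @ [j])"
    "length ks = weyl_length n \<alpha> (word_map \<alpha> (is @ [j]))"
    by (auto simp: reduced_expression_def)
  have "- word_map \<alpha> ks (\<alpha> j) \<in> pos"
    using p by (simp add: ks' word_map_append reflection_self linear_neg[OF linear_word_map])
  then obtain ls where ls: "set ls \<subseteq> {1..n}" "length ls < length ks"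
    "word_map \<alpha> (ks @ [j]) = word_map \<alpha> ls"
    using exchange ks'(1) j by blast
  have "word_map \<alpha> (ks @ [j]) = word_map \<alpha> is"
    by (simp add: word_map_append ks'(2) comp_assoc reflection_comp_self)
  then have "weyl_length n \<alpha> (word_map \<alpha> is) < weyl_length n \<alpha> (word_map \<alpha> (is @ [j]))"
    using weyl_length_le[OF ls(1), of \<alpha>] ls(2,3) ks'(3) by simp
  moreover have "word_map \<alpha> (is @ [j]) \<in> weyl_group \<Phi>"
    using word_map_in_weyl_group[OF sub] .
  ultimately show False
    using long by (auto simp: longest_element_def is_arg_max_def)
qed

text \<open>By linearity the claim reduces to simple roots: natural combinations of natural
  combinations of simple roots are again such combinations.\<close>

lemma longest_element_pos_neg:
  assumes long: "longest_element \<Phi> n \<alpha> (word_map \<alpha> is)"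
    and "is": "set is \<subseteq> {1..n}" and b: "b \<in> pos"
  shows "- word_map \<alpha> is b \<in> pos"
proof -
  obtain c :: "nat \<Rightarrow> nat" where c: "b = (\<Sum>i\<in>{1..n}. real (c i) *\<^sub>R \<alpha> i)"
    using b by (auto simp: positive_roots_def)
  have "\<forall>j\<in>{1..n}. \<exists>d::nat \<Rightarrow> nat. - word_map \<alpha> is (\<alpha> j) = (\<Sum>i\<in>{1..n}. real (d i) *\<^sub>R \<alpha> i)"
    using longest_element_simple_root_neg[OF long "is"] by (auto simp: positive_roots_def)
  then obtain d :: "nat \<Rightarrow> nat \<Rightarrow> nat"
    where d: "\<And>j. j \<in> {1..n} \<Longrightarrow> - word_map \<alpha> is (\<alpha> j) = (\<Sum>i\<in>{1..n}. real (d j i) *\<^sub>R \<alpha> i)"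
    by metis
  have "- word_map \<alpha> is b = (\<Sum>j\<in>{1..n}. real (c j) *\<^sub>R (- word_map \<alpha> is (\<alpha> j)))"
    unfolding c
    by (simp add: linear_sum[OF linear_word_map] linear_scale[OF linear_word_map] sum_negf)
  also have "\<dots> = (\<Sum>j\<in>{1..n}. real (c j) *\<^sub>R (\<Sum>i\<in>{1..n}. real (d j i) *\<^sub>R \<alpha> i))"
    by (intro sum.cong refl arg_cong[where f = "scaleR _"] d)
  also have "\<dots> = (\<Sum>i\<in>{1..n}. \<Sum>j\<in>{1..n}. (real (c j) * real (d j i)) *\<^sub>R \<alpha> i)"
    unfolding scaleR_sum_right scaleR_scaleR by (rule sum.swap)
  also have "\<dots> = (\<Sum>i\<in>{1..n}. real (\<Sum>j\<in>{1..n}. c j * d j i) *\<^sub>R \<alpha> i)"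
    by (simp add: scaleR_sum_left)
  finally have eq: "- word_map \<alpha> is b = (\<Sum>i\<in>{1..n}. real (\<Sum>j\<in>{1..n}. c j * d j i) *\<^sub>R \<alpha> i)" .
  have "word_map \<alpha> is b \<in> \<Phi>"
    using word_map_root "is" pos_in_roots[OF b] by blast
  \<comment> \<open>A root reflected in itself is its negative, so the roots are closed under
    negation.\<close>
  then have "- word_map \<alpha> is b \<in> \<Phi>"
    using pos_or_neg pos_in_roots reflection_root reflection_self by metis
  with eq show ?thesis
    unfolding positive_roots_def by (intro CollectI conjI exI)
qed

text \<open>The reversed word is the inverse element, so the letters of \<open>is\<close> act on
  \<open>b\<close> from left to right. The first sign change, at \<open>j\<close> after the prefix
  \<open>xs\<close>, happens at the simple root of \<open>j\<close>; undoing \<open>xs\<close>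
  recovers \<open>b\<close>.\<close>

lemma sign_change_position:
  assumes "set is \<subseteq> {1..n}" and "b \<in> pos" and "- word_map \<alpha> (rev is) b \<in> pos"
  shows "\<exists>xs j ys. is = xs @ j # ys \<and> b = word_map \<alpha> xs (\<alpha> j)"
  using assms
proof (induction "is" arbitrary: b)
  case Nil
  then show ?case
    using pos_not_neg by auto
next
  case (Cons i "is")
  let ?b = "reflection (\<alpha> i) b"
  have i: "i \<in> {1..n}" and is_sub: "set is \<subseteq> {1..n}"
    using Cons.prems by auto
  show ?case
  proof (cases "- ?b \<in> pos")
    case True
    then have "b = \<alpha> i"
      using simple_reflection_pos i Cons.prems(2) by blast
    then show ?thesis
      by (intro exI[of _ "[]"]) auto
  next
    case False
    then have "?b \<in> pos"
      using pos_or_neg reflection_root simple_root_in[OF i] pos_in_roots Cons.prems(2) by blast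
    moreover have "- word_map \<alpha> (rev is) ?b \<in> pos"
      using Cons.prems(3) by (simp add: word_map_append)
    ultimately obtain xs j ys where "is = xs @ j # ys" "?b = word_map \<alpha> xs (\<alpha> j)"
      using Cons.IH is_sub by blast
    then have "i # is = (i # xs) @ j # ys \<and> b = word_map \<alpha> (i # xs) (\<alpha> j)"
      by (metis append_Cons comp_apply reflection_involution word_map_Cons)
    then show ?thesis
      by blast
  qed
qed

proposition positive_roots_longest_element:
  assumes long: "longest_element \<Phi> n \<alpha> w" and red: "reduced_expression n \<alpha> is w"
  shows "pos = {word_map \<alpha> xs (\<alpha> j) | xs j ys. is = xs @ j # ys}"
proof
  have "is": "set is \<subseteq> {1..n}" and w: "word_map \<alpha> is = w"
    using red by (auto simp: reduced_expression_def)
  show "pos \<subseteq> {word_map \<alpha> xs (\<alpha> j) | xs j ys. is = xs @ j # ys}"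
  proof
    fix b assume b: "b \<in> pos"
    let ?b = "word_map \<alpha> (rev is) b"
    \<comment> \<open>The word maps \<open>?b\<close> back to \<open>b\<close>. Were
      \<open>?b\<close> positive, the longest element would make \<open>b\<close> negative.\<close>
    have "?b \<notin> pos"
      using longest_element_pos_neg[of "is" ?b] long w "is" b pos_not_neg
      by (auto simp: word_map_rev)
    moreover have "?b \<in> \<Phi>"
      using "is" pos_in_roots[OF b] by (intro word_map_root) auto
    ultimately have "- ?b \<in> pos"
      using pos_or_neg by blast
    then show "b \<in> {word_map \<alpha> xs (\<alpha> j) | xs j ys. is = xs @ j # ys}"
      using sign_change_position[OF "is" b] by blast
  qed
  show "{word_map \<alpha> xs (\<alpha> j) | xs j ys. is = xs @ j # ys} \<subseteq> pos"
    using red reduced_prefix_root_pos by blast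
qed

section \<open>Coordinates in the fundamental weights\<close>

lemma fundamental_weights_expansion:
  assumes "fundamental_weights n \<alpha> \<omega>"
  shows "x = (\<Sum>l\<in>{1..n}. cartan x (\<alpha> l) *\<^sub>R \<omega> l)"
proof -
  define y where "y = x - (\<Sum>l\<in>{1..n}. cartan x (\<alpha> l) *\<^sub>R \<omega> l)"
  have "y \<bullet> \<alpha> j = 0" if j: "j \<in> {1..n}" for j
  proof -
    have cartan_sum: "cartan (\<Sum>l\<in>S. f l) a = (\<Sum>l\<in>S. cartan (f l) a)" for f S and a :: 'a
      by (simp add: cartan_def inner_sum_left sum_distrib_left sum_divide_distrib)
    have "cartan (\<Sum>l\<in>{1..n}. cartan x (\<alpha> l) *\<^sub>R \<omega> l) (\<alpha> j)
        = (\<Sum>l\<in>{1..n}. if l = j then cartan x (\<alpha> l) else 0)"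
      unfolding cartan_sum cartan_scaleR
      using assms j by (intro sum.cong) (auto simp: fundamental_weights_def)
    then have "cartan y (\<alpha> j) = 0"
      using j by (simp add: y_def cartan_diff)
    moreover have "\<alpha> j \<noteq> 0"
      using simple_root_in[OF j] root_system by (auto simp: root_system_def)
    ultimately show ?thesis
      by (simp add: cartan_def)
  qed
  \<comment> \<open>The error \<open>y\<close> is orthogonal to the simple roots, which span the
    space, hence to itself.\<close>
  then have "orthogonal y z" if "z \<in> \<alpha> ` {1..n}" for z
    using that by (auto simp: orthogonal_def)
  then have "orthogonal y y"
    using orthogonal_to_span[of y "\<alpha> ` {1..n}" y] span_simple_roots by auto
  then show ?thesis
    by (simp add: y_def orthogonal_self)
qed

end

subsection \<open>The Ringel form under reflection at a sink\<close>

lemma orientation_of_flip_at: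
  assumes "orientation_of D Q" and "is_sink Q k"
  shows "orientation_of D (flip_at k Q)"
  unfolding orientation_of_def
proof (intro conjI allI impI)
  have edge: "{i, j} \<in> D" if "(i, j) \<in> Q" for i j
    using assms(1) that by (simp add: orientation_of_def)
  \<comment> \<open>At a sink no arrow leaves \<open>k\<close>, so after the flip the arrows at
    \<open>k\<close> are exactly the reversed incoming ones.\<close>
  have flip: "(i, j) \<in> flip_at k Q \<longleftrightarrow> (if i = k \<or> j = k then i = k \<and> (j, i) \<in> Q else (i, j) \<in> Q)"
    for i j
    using assms(2) by (auto simp: flip_at_def is_sink_def)
  show "{i, j} \<in> D" if "(i, j) \<in> flip_at k Q" for i j
    using that edge[of i j] edge[of j i] by (auto simp: flip insert_commute split: if_splits)
  show "((i, j) \<in> flip_at k Q) \<noteq> ((j, i) \<in> flip_at k Q)" if "{i, j} \<in> D" for i j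
  proof -
    have "((i, j) \<in> Q) \<noteq> ((j, i) \<in> Q)"
      using assms(1) that by (simp add: orientation_of_def)
    then show ?thesis
      using assms(2) by (auto simp: flip is_sink_def)
  qed
qed

lemma orientation_of_irrefl: "orientation_of D Q \<Longrightarrow> (i, i) \<notin> Q"
  unfolding orientation_of_def by blast

text \<open>Each edge carries exactly one arrow, so just one of the two summands is -1; on the
  diagonal both are 1.\<close>

lemma cartan_ringel_form:
  assumes "orientation_of D Q" and "has_diagram n D \<alpha>" and "ringel_form n \<alpha> Q R"
    and "i \<in> {1..n}" and "j \<in> {1..n}"
  shows "cartan (\<alpha> i) (\<alpha> j) = R (\<alpha> i) (\<alpha> j) + R (\<alpha> j) (\<alpha> i)"
proof -
  have "{i, j} \<in> D \<longleftrightarrow> (i, j) \<in> Q \<or> (j, i) \<in> Q" "\<not> ((i, j) \<in> Q \<and> (j, i) \<in> Q)"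
    using assms(1) unfolding orientation_of_def by (metis insert_commute)+
  then show ?thesis
    using assms(2-) by (auto simp: has_diagram_def ringel_form_def)
qed

lemma ringel_form_sink:
  assumes "ringel_form n \<alpha> Q R" and "is_sink Q k" and "k \<in> {1..n}" and "j \<in> {1..n}"
  shows "R (\<alpha> k) (\<alpha> j) = (if k = j then 1 else 0)"
  using assms by (auto simp: ringel_form_def is_sink_def)

lemma ringel_form_flip_at:
  assumes ori: "orientation_of D Q" and diag: "has_diagram n D \<alpha>" and R: "ringel_form n \<alpha> Q R"
    and k: "k \<in> {1..n}" and sink: "is_sink Q k"
  shows "ringel_form n \<alpha> (flip_at k Q) (\<lambda>x y. R (reflection (\<alpha> k) x) (reflection (\<alpha> k) y))"
  unfolding ringel_form_def
proof (intro conjI ballI)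
  have bil: "bilinear R"
    using R by (simp add: ringel_form_def)
  show "bilinear (\<lambda>x y. R (reflection (\<alpha> k) x) (reflection (\<alpha> k) y))"
    using bil linear_compose[OF linear_reflection] unfolding bilinear_def o_def by blast
  fix i j assume i: "i \<in> {1..n}" and j: "j \<in> {1..n}"
  note c = cartan_ringel_form[OF ori diag R _ k]
  note s = ringel_form_sink[OF R sink k]
  have "R (reflection (\<alpha> k) (\<alpha> i)) (reflection (\<alpha> k) (\<alpha> j)) =
      R (\<alpha> i) (\<alpha> j) - cartan (\<alpha> i) (\<alpha> k) * R (\<alpha> k) (\<alpha> j) - cartan (\<alpha> j) (\<alpha> k) * R (\<alpha> i) (\<alpha> k)
      + cartan (\<alpha> i) (\<alpha> k) * cartan (\<alpha> j) (\<alpha> k) * R (\<alpha> k) (\<alpha> k)"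
    by (simp add: reflection_def bilinear_lsub[OF bil] bilinear_rsub[OF bil]
        bilinear_lmul[OF bil] bilinear_rmul[OF bil] algebra_simps)
  also have "\<dots> = (if i = j then 1 else if (i, j) \<in> flip_at k Q then -1 else 0)"
  proof (cases "i = k \<or> j = k")
    case True
    then show ?thesis
      using i j k R sink orientation_of_irrefl[OF ori] unfolding c[OF i] c[OF j]
      by (auto simp: s flip_at_def ringel_form_def is_sink_def)
  next
    case False
    then have "R (\<alpha> k) (\<alpha> i) = 0" "R (\<alpha> k) (\<alpha> j) = 0" "R (\<alpha> k) (\<alpha> k) = 1"
      using s[OF i] s[OF j] s[OF k] by auto
    moreover have "(i, j) \<in> flip_at k Q \<longleftrightarrow> (i, j) \<in> Q"
      using False by (auto simp: flip_at_def)
    \<comment> \<open>Since \<open>k\<close> is a sink, each Cartan number with \<open>k\<close> is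
      the single value of \<open>R\<close> in the second slot \<open>k\<close>. The last two
      correction terms are then opposite products and cancel.\<close>
    ultimately show ?thesis
      using i j R unfolding c[OF i] c[OF j] by (simp add: ringel_form_def)
  qed
  finally show "R (reflection (\<alpha> k) (\<alpha> i)) (reflection (\<alpha> k) (\<alpha> j)) =
    (if i = j then 1 else if (i, j) \<in> flip_at k Q then -1 else 0)" .
qed

section \<open>Weights along an adapted word\<close>

lemma adapted_append: "adapted Q (xs @ ys) \<Longrightarrow> adapted Q xs"
  by (induction xs arbitrary: Q) auto

text \<open>Induction on the prefix with \<open>Q\<close> and \<open>R\<close> free: removing the
  first letter \<open>i\<close> replaces the quiver by its flip at \<open>i\<close> and the form by
  its transport under \<open>s_i\<close>.\<close>

lemma cartan_chamber_weight:
  assumes diag: "has_diagram n D \<alpha>" and \<omega>: "fundamental_weights n \<alpha> \<omega>"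
    and "orientation_of D Q" and "ringel_form n \<alpha> Q R" and "adapted Q (is @ [j])"
    and "set (is @ [j]) \<subseteq> {1..n}" and "l \<in> {1..n}"
  shows "cartan (word_map \<alpha> (is @ [j]) (\<omega> j)) (\<alpha> l) = - R (\<alpha> l) (word_map \<alpha> is (\<alpha> j))"
  using assms(3-)
proof (induction "is" arbitrary: Q R l)
  case Nil
  \<comment> \<open>Here the weight is \<omega>\<open>j\<close> - \<alpha>\<open>j\<close>. The
    Kronecker delta from \<omega>\<open>j\<close> cancels \<open>R\<close>
    (\<alpha>\<open>j\<close>) (\<alpha>\<open>l\<close>), because \<open>j\<close> is a
    sink.\<close>
  then show ?case
    using \<omega> cartan_ringel_form[OF Nil(1) diag Nil(2), of j l] ringel_form_sink[OF Nil(2), of j l]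
    by (auto simp: reflection_def cartan_diff cartan_scaleR fundamental_weights_def)
next
  case (Cons i "is")
  define R' where "R' = (\<lambda>x y. R (reflection (\<alpha> i) x) (reflection (\<alpha> i) y))"
  define \<mu> where "\<mu> = word_map \<alpha> (is @ [j]) (\<omega> j)"
  define \<beta> where "\<beta> = word_map \<alpha> is (\<alpha> j)"
  have i: "i \<in> {1..n}" and sink: "is_sink Q i" and l: "l \<in> {1..n}"
    using Cons.prems by auto
  have R': "ringel_form n \<alpha> (flip_at i Q) R'"
    unfolding R'_def by (rule ringel_form_flip_at[OF Cons.prems(1) diag Cons.prems(2) i sink])
  then have bil: "bilinear R'"
    by (simp add: ringel_form_def)
  have IH: "cartan \<mu> (\<alpha> m) = - R' (\<alpha> m) \<beta>" if "m \<in> {1..n}" for m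
    unfolding \<mu>_def \<beta>_def
    using Cons.prems R' orientation_of_flip_at that by (intro Cons.IH) auto
  \<comment> \<open>Symmetry of the simply laced Cartan matrix moves the reflection from the weight
    to the root paired with it.\<close>
  have sym: "cartan (\<alpha> i) (\<alpha> l) = cartan (\<alpha> l) (\<alpha> i)"
    using diag i l by (auto simp: has_diagram_def insert_commute)
  have "cartan (word_map \<alpha> ((i # is) @ [j]) (\<omega> j)) (\<alpha> l) = cartan (reflection (\<alpha> i) \<mu>) (\<alpha> l)"
    by (simp add: \<mu>_def)
  also have "\<dots> = - (R' (\<alpha> l) \<beta> - cartan (\<alpha> l) (\<alpha> i) * R' (\<alpha> i) \<beta>)"
    unfolding reflection_def cartan_diff cartan_scaleR IH[OF i] IH[OF l] sym by simp
  also have "\<dots> = - R' (reflection (\<alpha> i) (\<alpha> l)) \<beta>"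
    by (simp add: reflection_def bilinear_lsub[OF bil] bilinear_lmul[OF bil])
  \<comment> \<open>In the first slot the reflection meets the one inside \<open>R'\<close> and
    disappears; in the second, \<open>R'\<close> supplies the missing letter
    \<open>i\<close>.\<close>
  also have "\<dots> = - R (\<alpha> l) (word_map \<alpha> (i # is) (\<alpha> j))"
    by (simp add: R'_def \<beta>_def reflection_involution)
  finally show ?case .
qed

text \<open>This indexes the weights by the same splittings of the word as the positive roots. The
  prefix of length \<open>k\<close> includes its last letter \<open>is ! (k - 1)\<close>, so
  \<open>k\<close> is \<open>Suc (length xs)\<close>.\<close>

lemma chamber_weights_split:
  "chamber_weights \<alpha> \<omega> is =
    {word_map \<alpha> (xs @ [j]) (\<omega> j) | xs j ys. is = xs @ j # ys}"
proof (intro set_eqI iffI)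
  fix x assume "x \<in> chamber_weights \<alpha> \<omega> is"
  then obtain k where "1 \<le> k" "k \<le> length is" "x = word_map \<alpha> (take k is) (\<omega> (is ! (k - 1)))"
    by (auto simp: chamber_weights_def)
  then obtain m where m: "m < length is" "x = word_map \<alpha> (take (Suc m) is) (\<omega> (is ! m))"
    using that[of "k - 1"] by simp
  then have "x = word_map \<alpha> (take m is @ [is ! m]) (\<omega> (is ! m))"
    "is = take m is @ is ! m # drop (Suc m) is"
    by (simp_all add: take_Suc_conv_app_nth id_take_nth_drop)
  then show "x \<in> {word_map \<alpha> (xs @ [j]) (\<omega> j) | xs j ys. is = xs @ j # ys}"
    by blast
next
  fix x assume "x \<in> {word_map \<alpha> (xs @ [j]) (\<omega> j) | xs j ys. is = xs @ j # ys}"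
  then obtain xs j ys where "is = xs @ j # ys" "x = word_map \<alpha> (xs @ [j]) (\<omega> j)"
    by blast
  then show "x \<in> chamber_weights \<alpha> \<omega> is"
    unfolding chamber_weights_def by (intro CollectI exI[of _ "Suc (length xs)"]) simp
qed

theorem corollary2p5:
  fixes n :: nat and D :: "nat set set" and Q :: "(nat \<times> nat) set"
    and \<Phi> :: "'a::euclidean_space set" and \<alpha> \<omega> :: "nat \<Rightarrow> 'a"
    and R :: "'a \<Rightarrow> 'a \<Rightarrow> real" and w0 :: "'a \<Rightarrow> 'a" and "is" :: "nat list"
  assumes "ADE_diagram n D"
    and "orientation_of D Q"
    and "root_system \<Phi>" and "simple_roots \<Phi> n \<alpha>" and "has_diagram n D \<alpha>"
    and "fundamental_weights n \<alpha> \<omega>"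
    and "ringel_form n \<alpha> Q R"
    and "longest_element \<Phi> n \<alpha> w0"
    and "reduced_expression n \<alpha> is w0"
    and "adapted Q is"
  shows "(\<forall>i\<in>{1..n}. - rho n \<alpha> \<omega> R i \<in> chamber_weights \<alpha> \<omega> is) \<and>
    chamber_weights \<alpha> \<omega> is =
      {\<Sum>i\<in>{1..n}. a i *\<^sub>R (- rho n \<alpha> \<omega> R i) | a :: nat \<Rightarrow> real.
         (\<Sum>i\<in>{1..n}. a i *\<^sub>R \<alpha> i) \<in> positive_roots \<Phi> n \<alpha>}"
proof -
  interpret simple_system \<Phi> n \<alpha>
    by standard fact+
  \<comment> \<open>This map is given by its coordinates in the fundamental weights, so that it can
    be compared with the weights one Cartan number at a time.\<close>
  define \<psi> where "\<psi> = (\<lambda>x. \<Sum>l\<in>{1..n}. (- R (\<alpha> l) x) *\<^sub>R \<omega> l)"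
  have bil: "bilinear R"
    using assms by (simp add: ringel_form_def)
  have "linear \<psi>"
    by (rule linearI)
      (simp_all add: \<psi>_def bilinear_radd[OF bil] bilinear_rmul[OF bil] scaleR_add_left
        sum_negf scaleR_sum_right sum.distrib)
  have \<psi>_simple: "\<psi> (\<alpha> i) = - rho n \<alpha> \<omega> R i" for i
    by (simp add: \<psi>_def rho_def sum_negf)
  have \<psi>_sum: "\<psi> (\<Sum>i\<in>{1..n}. a i *\<^sub>R \<alpha> i) = (\<Sum>i\<in>{1..n}. a i *\<^sub>R (- rho n \<alpha> \<omega> R i))" for a
    by (simp only: linear_sum[OF \<open>linear \<psi>\<close>] linear_scale[OF \<open>linear \<psi>\<close>] \<psi>_simple)
  have "word_map \<alpha> (xs @ [j]) (\<omega> j) = \<psi> (word_map \<alpha> xs (\<alpha> j))" if "is = xs @ j # ys" for xs j ys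
  proof -
    have "adapted Q (xs @ [j])" "set (xs @ [j]) \<subseteq> {1..n}"
      using that assms(9,10) adapted_append[of Q "xs @ [j]" ys]
      by (auto simp: reduced_expression_def)
    then have "cartan (word_map \<alpha> (xs @ [j]) (\<omega> j)) (\<alpha> l) = - R (\<alpha> l) (word_map \<alpha> xs (\<alpha> j))"
      if "l \<in> {1..n}" for l
      using cartan_chamber_weight[OF assms(5,6,2,7)] that by blast
    then show ?thesis
      unfolding \<psi>_def
      by (subst fundamental_weights_expansion[OF assms(6)]) (intro sum.cong, auto)
  qed
  then have "chamber_weights \<alpha> \<omega> is = {\<psi> (word_map \<alpha> xs (\<alpha> j)) | xs j ys. is = xs @ j # ys}"
    unfolding chamber_weights_split by (intro Collect_cong) metis
  also have "\<dots> = \<psi> ` pos"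
    unfolding positive_roots_longest_element[OF assms(8,9)] by blast
  finally have image: "chamber_weights \<alpha> \<omega> is = \<psi> ` pos" .
  show ?thesis
  proof (intro conjI ballI)
    show "- rho n \<alpha> \<omega> R i \<in> chamber_weights \<alpha> \<omega> is" if "i \<in> {1..n}" for i
      unfolding image \<psi>_simple[symmetric] using simple_root_pos[OF that] by blast
    \<comment> \<open>The coefficients on the right range over real families; the natural
      coefficients of a positive root provide one.\<close>
    have "\<psi> ` pos = {\<psi> (\<Sum>i\<in>{1..n}. a i *\<^sub>R \<alpha> i) | a :: nat \<Rightarrow> real. (\<Sum>i\<in>{1..n}. a i *\<^sub>R \<alpha> i) \<in> pos}"
      (is "_ = ?S")
    proof
      show "\<psi> ` pos \<subseteq> ?S"
      proof
        fix x assume "x \<in> \<psi> ` pos"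
        then obtain b where b: "b \<in> pos" "x = \<psi> b"
          by blast
        then obtain c :: "nat \<Rightarrow> nat" where "b = (\<Sum>i\<in>{1..n}. real (c i) *\<^sub>R \<alpha> i)"
          by (auto simp: positive_roots_def)
        with b show "x \<in> ?S"
          by (intro CollectI exI[of _ "\<lambda>i. real (c i)"]) simp
      qed
    qed blast
    then show "chamber_weights \<alpha> \<omega> is =
      {\<Sum>i\<in>{1..n}. a i *\<^sub>R (- rho n \<alpha> \<omega> R i) | a :: nat \<Rightarrow> real. (\<Sum>i\<in>{1..n}. a i *\<^sub>R \<alpha> i) \<in> pos}"
      unfolding image \<psi>_sum .
  qed
qed

end
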